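(* Let $X$ and $Y$ be random elements taking values in measurable spaces $\Omega_X$ and $\Omega_Y$. If the family of conditional distributions $\{P_{X|Y}(\cdot\,|\,y): y\in\Omega_Y\}$ is dominated by a $\sigma$-finite measure, then $$L_2(P_X)\ominus\bigl[L_2(P_X)\ominus L_2(P_Y)\bigr]\subseteq \mathfrak S_{Y|X},$$ where $\mathfrak S_{Y|X}$ is the central class for $Y$ versus $X$.
   Context: $X,Y$ are defined on a probability space $(\Omega,\mathcal F,P)$ and take values in measurable spaces $(\Omega_X,\mathcal F_X)$, $(\Omega_Y,\mathcal F_Y)$; $(X,Y)$ takes values in the product space. $P_X,P_Y,P_{XY}$ are their distributions, dominated by $\sigma$-finite measures, and $P_{X|Y}(\cdot|y)$ is the (regular) conditional distribution of $X$ given $Y=y$. $\sigma(X)=X^{-1}(\mathcal F_X)$. $L_2(P_X)$, $L_2(P_Y)$, $L_2(P_{XY})$ denote the spaces of square-integrable real functions with mean zero (all functions are centered); $L_2(P_X)$ and $L_2(P_Y)$ are viewed as closed subspaces of $L_2(P_{XY})$. For subspaces $\mathcal S_1,\mathcal S_2$ of a Hilbert space, $\mathcal S_1\ominus\mathcal S_2=\mathcal S_1\cap\mathcal S_2^\perp$. The central $\sigma$-field $\mathcal G_{Y|X}$ is the smallest (modulo $P$-null sets) sub $\sigma$-field $\mathcal G$ of $\sigma(X)$ such that $Y$ and $X$ are conditionally independent given $\mathcal G$; it exists and is unique modulo null sets when $\{P_{X|Y}(\cdot|y):y\in\Omega_Y\}$ is dominated by a $\sigma$-finite measure. The central class $\mathfrak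 S_{Y|X}$ is the set of all $f\in L_2(P_X)$ such that $f(X)$ is $\mathcal G_{Y|X}$-measurable (up to a.s. equality). *)

theory Defs
  imports "HOL-Probability.Probability"
begin

(* Sub-sigma-fields of a probability space M are measures G with subalgebra M G: only
   space and sets of G matter, its own measure is never used.  Elements of L2 spaces are
   represented by functions; sets of functions below that play the role of subspaces of
   L2(P_XY) are closed under almost sure equality. *)

definition generated_field :: "'a measure \<Rightarrow> 'b measure \<Rightarrow> ('a \<Rightarrow> 'b) \<Rightarrow> 'a measure" where
  "generated_field M MX X = vimage_algebra (space M) X MX"

definition joint_distr ::
  "'a measure \<Rightarrow> 'b measure \<Rightarrow> 'c measure \<Rightarrow> ('a \<Rightarrow> 'b) \<Rightarrow> ('a \<Rightarrow> 'c) \<Rightarrow> ('b \<times> 'c) measure" where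
  "joint_distr M MX MY X Y = distr M (MX \<Otimes>\<^sub>M MY) (\<lambda>\<omega>. (X \<omega>, Y \<omega>))"

definition cond_prob_field :: "'a measure \<Rightarrow> 'a measure \<Rightarrow> 'a set \<Rightarrow> 'a \<Rightarrow> real" where
  "cond_prob_field M G A = real_cond_exp M G (indicator A)"

definition regular_cond_distr ::
  "'a measure \<Rightarrow> 'b measure \<Rightarrow> 'c measure \<Rightarrow> ('a \<Rightarrow> 'b) \<Rightarrow> ('a \<Rightarrow> 'c) \<Rightarrow> ('c \<Rightarrow> 'b measure) \<Rightarrow> bool" where
  "regular_cond_distr M MX MY X Y K \<longleftrightarrow>
     K \<in> measurable MY (prob_algebra MX) \<and>
     (\<forall>A\<in>sets MX. AE \<omega> in M. measure (K (Y \<omega>)) A =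
        cond_prob_field M (generated_field M MY Y) (X -` A \<inter> space M) \<omega>)"

definition dominated_family :: "'b measure \<Rightarrow> ('i \<Rightarrow> 'b measure) \<Rightarrow> 'i set \<Rightarrow> bool" where
  "dominated_family MX K I \<longleftrightarrow>
     (\<exists>\<mu>. sigma_finite_measure \<mu> \<and> sets \<mu> = sets MX \<and> (\<forall>i\<in>I. absolutely_continuous \<mu> (K i)))"

definition cond_indep_given ::
  "'a measure \<Rightarrow> 'b measure \<Rightarrow> 'c measure \<Rightarrow> ('a \<Rightarrow> 'b) \<Rightarrow> ('a \<Rightarrow> 'c) \<Rightarrow> 'a measure \<Rightarrow> bool" where
  "cond_indep_given M MX MY X Y G \<longleftrightarrow>
     (\<forall>A\<in>sets MX. \<forall>B\<in>sets MY. AE \<omega> in M.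
        cond_prob_field M G ((X -` A \<inter> space M) \<inter> (Y -` B \<inter> space M)) \<omega> =
        cond_prob_field M G (X -` A \<inter> space M) \<omega> * cond_prob_field M G (Y -` B \<inter> space M) \<omega>)"

definition subfield_mod_null :: "'a measure \<Rightarrow> 'a measure \<Rightarrow> 'a measure \<Rightarrow> bool" where
  "subfield_mod_null M G H \<longleftrightarrow>
     (\<forall>A\<in>sets G. \<exists>B\<in>sets H. AE \<omega> in M. \<omega> \<in> A \<longleftrightarrow> \<omega> \<in> B)"

definition sufficient_field ::
  "'a measure \<Rightarrow> 'b measure \<Rightarrow> 'c measure \<Rightarrow> ('a \<Rightarrow> 'b) \<Rightarrow> ('a \<Rightarrow> 'c) \<Rightarrow> 'a measure \<Rightarrow> bool" where
  "sufficient_field M MX MY X Y G \<longleftrightarrow>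
     subalgebra (generated_field M MX X) G \<and> cond_indep_given M MX MY X Y G"

(* Any two central fields agree modulo null sets, by definition. *)
definition central_field ::
  "'a measure \<Rightarrow> 'b measure \<Rightarrow> 'c measure \<Rightarrow> ('a \<Rightarrow> 'b) \<Rightarrow> ('a \<Rightarrow> 'c) \<Rightarrow> 'a measure \<Rightarrow> bool" where
  "central_field M MX MY X Y G \<longleftrightarrow>
     sufficient_field M MX MY X Y G \<and>
     (\<forall>H. sufficient_field M MX MY X Y H \<longrightarrow> subfield_mod_null M G H)"

definition L2c :: "'d measure \<Rightarrow> ('d \<Rightarrow> real) set" where
  "L2c P = {f \<in> borel_measurable P. integrable P (\<lambda>x. (f x)\<^sup>2) \<and> (LINT x|P. f x) = 0}"

(* The subspace of L2c P consisting (up to a.s. equality) of the functions f o p, f in S;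
   p = fst and p = snd embed L2(P_X) and L2(P_Y) into L2(P_XY). *)
definition L2c_lift :: "'e measure \<Rightarrow> ('e \<Rightarrow> 'd) \<Rightarrow> ('d \<Rightarrow> real) set \<Rightarrow> ('e \<Rightarrow> real) set" where
  "L2c_lift P p S = {h \<in> L2c P. \<exists>f\<in>S. AE z in P. h z = f (p z)}"

definition L2_ominus ::
  "'e measure \<Rightarrow> ('e \<Rightarrow> real) set \<Rightarrow> ('e \<Rightarrow> real) set \<Rightarrow> ('e \<Rightarrow> real) set" where
  "L2_ominus P S T = {h \<in> S. \<forall>g\<in>T. (LINT z|P. h z * g z) = 0}"

(* The choice of G does not matter; the class is empty if there were no central field. *)
definition central_class ::
  "'a measure \<Rightarrow> 'b measure \<Rightarrow> 'c measure \<Rightarrow> ('a \<Rightarrow> 'b) \<Rightarrow> ('a \<Rightarrow> 'c) \<Rightarrow> ('b \<Rightarrow> real) set" where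
  "central_class M MX MY X Y =
     {f \<in> L2c (distr M MX X). \<exists>G. central_field M MX MY X Y G \<and>
        (\<exists>h\<in>borel_measurable G. AE \<omega> in M. f (X \<omega>) = h \<omega>)}"

end

theory Submission
  imports Defs
begin

text \<open>
  The central \<sigma>-field has an explicit description: it is generated by the conditional
  probabilities of the events \<open>Y \<in> B\<close> given \<open>X\<close>.  Write \<open>G\<close> for this field.  Since
  \<open>P(Y \<in> B | X)\<close> is \<open>G\<close>-measurable, the tower property gives conditional independence of \<open>X\<close>
  and \<open>Y\<close> given \<open>G\<close>; and since conditional independence given any \<open>H \<subseteq> \<sigma>(X)\<close> forces
  \<open>P(Y \<in> B | X) = P(Y \<in> B | H)\<close> almost surely, every such \<open>H\<close> contains \<open>G\<close> modulo null sets
  (\<open>central_field_regression_field\<close>).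

  Now let \<open>f(X)\<close> be square integrable and centered, and put \<open>r = f(X) - E[f(X) | G]\<close>.  For each
  \<open>B\<close>, \<open>E[r 1\<^sub>B(Y)] = E[r P(Y \<in> B | X)] = 0\<close>, because the second factor is \<open>G\<close>-measurable while
  \<open>r\<close> has conditional mean zero given \<open>G\<close>.  Hence \<open>E[r | Y] = 0\<close> and \<open>r\<close> is orthogonal to every
  square integrable function of \<open>Y\<close> (\<open>orthogonal_if_cond_exp_regression_zero\<close>).  Thus \<open>r\<close> lies in
  \<open>L\<^sub>2(P\<^sub>X) \<ominus> L\<^sub>2(P\<^sub>Y)\<close>.  If \<open>f(X)\<close> is orthogonal to this space, then \<open>E[f(X) r] = 0\<close>; as
  \<open>E[f(X) | G]\<close> is orthogonal to \<open>r\<close> too, \<open>E[r\<^sup>2] = 0\<close>, so \<open>f(X) = E[f(X) | G]\<close>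
  almost surely, and \<open>f\<close> belongs to the central class.
\<close>

section \<open>Preliminaries on measurability and square integrability\<close>

text \<open>
  The Doob-Dynkin factorization.  A function is recovered from its strict upper level sets as
  the supremum of the rationals below it, and each level set is pulled back along \<open>X\<close>; the value
  \<open>-\<infinity>\<close> stands for the rationals whose level set misses the point.
\<close>

lemma vimage_algebra_factorization:
  fixes w :: "'a \<Rightarrow> real"
  assumes X: "X \<in> \<Omega> \<rightarrow> space N" and w: "w \<in> borel_measurable (vimage_algebra \<Omega> X N)"
  obtains g where "g \<in> borel_measurable N" "\<And>\<omega>. \<omega> \<in> \<Omega> \<Longrightarrow> w \<omega> = g (X \<omega>)"
proof -
  have "\<exists>A\<in>sets N. {\<omega>\<in>\<Omega>. of_rat q < w \<omega>} = X -` A \<inter> \<Omega>" for q :: rat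
  proof -
    have "{\<omega>\<in>space (vimage_algebra \<Omega> X N). of_rat q < w \<omega>} \<in> sets (vimage_algebra \<Omega> X N)"
      using w by measurable
    then show ?thesis
      unfolding sets_vimage_algebra2[OF X] by auto
  qed
  then obtain A where A [measurable]: "\<And>q. A q \<in> sets N"
    and lev: "\<And>q. {\<omega>\<in>\<Omega>. of_rat q < w \<omega>} = X -` A q \<inter> \<Omega>"
    by metis
  define s where "s = (\<lambda>x. SUP q. if x \<in> A q then ereal (of_rat q) else -\<infinity>)"
  have [measurable]: "s \<in> borel_measurable N"
    unfolding s_def by measurable
  have "s (X \<omega>) = ereal (w \<omega>)" if "\<omega> \<in> \<Omega>" for \<omega>
  proof (rule antisym)
    have mem: "X \<omega> \<in> A q \<longleftrightarrow> of_rat q < w \<omega>" for q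
      using lev[of q] that by auto
    show "s (X \<omega>) \<le> ereal (w \<omega>)"
      unfolding s_def by (rule SUP_least) (auto simp: mem)
    show "ereal (w \<omega>) \<le> s (X \<omega>)"
    proof (rule dense_le)
      fix y assume "y < ereal (w \<omega>)"
      then obtain q where q: "y < ereal (of_rat q)" "of_rat q < w \<omega>"
      proof (cases y)
        case (real t)
        with \<open>y < ereal (w \<omega>)\<close> obtain q where "t < of_rat q" "of_rat q < w \<omega>"
          using of_rat_dense[of t "w \<omega>"] by auto
        with real that show ?thesis by auto
      next
        case MInf
        obtain q where "w \<omega> - 1 < of_rat q" "of_rat q < w \<omega>"
          using of_rat_dense[of "w \<omega> - 1" "w \<omega>"] by auto
        with MInf that show ?thesis by auto
      qed auto
      have "ereal (of_rat q) \<le> s (X \<omega>)"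
        unfolding s_def by (rule SUP_upper2[of q]) (auto simp: mem q)
      with q show "y \<le> s (X \<omega>)" by simp
    qed
  qed
  then show ?thesis
    by (intro that[of "\<lambda>x. real_of_ereal (s x)"]) auto
qed

lemma integrable_mult_of_square_integrable:
  fixes f g :: "'a \<Rightarrow> real"
  assumes [measurable]: "f \<in> borel_measurable M" "g \<in> borel_measurable M"
    and "integrable M (\<lambda>x. (f x)\<^sup>2)" "integrable M (\<lambda>x. (g x)\<^sup>2)"
  shows "integrable M (\<lambda>x. f x * g x)"
proof (rule Bochner_Integration.integrable_bound)
  show "integrable M (\<lambda>x. (f x)\<^sup>2 + (g x)\<^sup>2)" using assms by simp
  have "\<bar>a * b\<bar> \<le> a\<^sup>2 + b\<^sup>2" for a b :: real
  proof -
    have "2 * (\<bar>a\<bar> * \<bar>b\<bar>) \<le> a\<^sup>2 + b\<^sup>2" "0 \<le> \<bar>a\<bar> * \<bar>b\<bar>"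
      using sum_squares_bound[of "\<bar>a\<bar>" "\<bar>b\<bar>"] by simp_all
    then show ?thesis unfolding abs_mult by linarith
  qed
  then show "AE x in M. norm (f x * g x) \<le> norm ((f x)\<^sup>2 + (g x)\<^sup>2)"
    by (intro AE_I2) (simp add: order_trans[OF _ abs_ge_self])
qed simp

lemma integrable_square_diff:
  fixes f g :: "'a \<Rightarrow> real"
  assumes [measurable]: "f \<in> borel_measurable M" "g \<in> borel_measurable M"
    and "integrable M (\<lambda>x. (f x)\<^sup>2)" "integrable M (\<lambda>x. (g x)\<^sup>2)"
  shows "integrable M (\<lambda>x. (f x - g x)\<^sup>2)"
  using assms integrable_mult_of_square_integrable[OF assms]
  by (simp add: power2_diff mult.assoc)

lemma (in sigma_finite_subalgebra) integrable_square_real_cond_exp: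
  fixes f :: "'a \<Rightarrow> real"
  assumes "integrable M f" "integrable M (\<lambda>x. (f x)\<^sup>2)"
  shows "integrable M (\<lambda>x. (real_cond_exp M F f x)\<^sup>2)"
  by (rule integrable_convex_cond_exp[where I = UNIV and q = "\<lambda>x. x\<^sup>2"])
     (use assms in \<open>auto intro: convex_power2\<close>)

section \<open>The central field\<close>

locale random_pair = prob_space M for M :: "'a measure" +
  fixes MX :: "'b measure" and MY :: "'c measure" and X :: "'a \<Rightarrow> 'b" and Y :: "'a \<Rightarrow> 'c"
  assumes X [measurable]: "X \<in> measurable M MX" and Y [measurable]: "Y \<in> measurable M MY"
begin

abbreviation FX :: "'a measure" where "FX \<equiv> generated_field M MX X"

abbreviation FY :: "'a measure" where "FY \<equiv> generated_field M MY Y"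

abbreviation event_Y :: "'c set \<Rightarrow> 'a set" where "event_Y B \<equiv> Y -` B \<inter> space M"

text \<open>
  Each conditional probability contributes one version.  The events \<open>B\<close> may be uncountably many,
  so two choices of versions need not agree outside a common null set; the comparison with other
  sufficient fields is nevertheless sound, as it is made set by set.
\<close>

definition regression_field :: "'a measure" where
  "regression_field = sigma (space M)
     {cond_prob_field M FX (event_Y B) -` S \<inter> space M | B S. B \<in> sets MY \<and> S \<in> sets borel}"

lemma space_FX [simp]: "space FX = space M"
  by (simp add: generated_field_def)

lemma sets_FX: "sets FX = {X -` A \<inter> space M | A. A \<in> sets MX}"
  unfolding generated_field_def
  by (intro sets_vimage_algebra2) (use measurable_space[OF X] in auto)

lemma sets_FY: "sets FY = {Y -` A \<inter> space M | A. A \<in> sets MY}"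
  unfolding generated_field_def
  by (intro sets_vimage_algebra2) (use measurable_space[OF Y] in auto)

lemma subalgebra_FX: "subalgebra M FX"
  unfolding subalgebra_def sets_FX using X by (auto intro: measurable_sets)

lemma subalgebra_FY: "subalgebra M FY"
  unfolding subalgebra_def sets_FY using Y
  by (auto intro: measurable_sets simp: generated_field_def)

lemma subalgebra_trans: "subalgebra FX G \<Longrightarrow> subalgebra M G"
  using subalgebra_FX unfolding subalgebra_def by auto

lemma sigma_finite_subalgebraI: "subalgebra M G \<Longrightarrow> sigma_finite_subalgebra M G"
  by (intro finite_measure_subalgebra_is_sigma_finite finite_measure_subalgebra.intro
        finite_measure_subalgebra_axioms.intro) unfold_locales

lemma cond_prob_field_FX_measurable: "cond_prob_field M FX A \<in> borel_measurable FX"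
  unfolding cond_prob_field_def by simp

lemma
  shows space_regression_field: "space regression_field = space M"
    and sets_regression_field: "sets regression_field = sigma_sets (space M)
     {cond_prob_field M FX (event_Y B) -` S \<inter> space M | B S. B \<in> sets MY \<and> S \<in> sets borel}"
  unfolding regression_field_def by (auto intro!: space_measure_of sets_measure_of)

lemma subalgebra_regression_field: "subalgebra FX regression_field"
  unfolding subalgebra_def
proof
  show "space regression_field = space FX"
    by (simp add: space_regression_field)
  have "sigma_sets (space FX)
     {cond_prob_field M FX (event_Y B) -` S \<inter> space M | B S. B \<in> sets MY \<and> S \<in> sets borel}
     \<subseteq> sets FX"
  proof (rule sets.sigma_sets_subset, safe)
    fix B :: "'c set" and S :: "real set" assume "S \<in> sets borel"
    from measurable_sets[OF cond_prob_field_FX_measurable this]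
    show "cond_prob_field M FX (event_Y B) -` S \<inter> space M \<in> sets FX"
      by simp
  qed
  then show "sets regression_field \<subseteq> sets FX"
    by (simp add: sets_regression_field)
qed

lemma cond_prob_field_regression_measurable:
  assumes "B \<in> sets MY"
  shows "cond_prob_field M FX (event_Y B) \<in> borel_measurable regression_field"
proof (rule measurableI)
  fix S :: "real set" assume "S \<in> sets borel"
  with assms show "cond_prob_field M FX (event_Y B) -` S \<inter> space regression_field
      \<in> sets regression_field"
    unfolding space_regression_field sets_regression_field by (intro sigma_sets.Basic) blast
qed simp

text \<open>
  Conditioning first on \<open>X\<close> turns the indicator of \<open>Y \<in> B\<close> into \<open>P(Y \<in> B | X)\<close>.  If \<open>G\<close> already
  measures this function, it is a constant for the conditioning on \<open>G\<close>.
\<close>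

lemma cond_indep_given_if_measurable:
  assumes G: "subalgebra FX G"
    and meas: "\<And>B. B \<in> sets MY \<Longrightarrow> cond_prob_field M FX (event_Y B) \<in> borel_measurable G"
  shows "cond_indep_given M MX MY X Y G"
  unfolding cond_indep_given_def
proof (intro ballI)
  fix A B assume [measurable]: "A \<in> sets MX" "B \<in> sets MY"
  interpret FX: sigma_finite_subalgebra M FX
    by (rule sigma_finite_subalgebraI[OF subalgebra_FX])
  interpret G: sigma_finite_subalgebra M G
    by (rule sigma_finite_subalgebraI[OF subalgebra_trans[OF G]])
  define a :: "'a \<Rightarrow> real" where "a = indicator (X -` A \<inter> space M)"
  define b :: "'a \<Rightarrow> real" where "b = indicator (event_Y B)"
  have ev: "X -` A \<inter> space M \<in> sets M" "event_Y B \<in> sets M" by measurable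
  have a [measurable]: "a \<in> borel_measurable M" and b [measurable]: "b \<in> borel_measurable M"
    and ab: "(\<lambda>\<omega>. a \<omega> * b \<omega>) = indicator (X -` A \<inter> space M \<inter> event_Y B)"
    unfolding a_def b_def using ev by (auto simp: fun_eq_iff indicator_inter_arith)
  have aX: "a \<in> borel_measurable FX"
    unfolding a_def by (intro borel_measurable_indicator) (auto simp: sets_FX)
  have int: "integrable M a" "integrable M b" "integrable M (\<lambda>\<omega>. a \<omega> * b \<omega>)"
    unfolding ab unfolding a_def b_def using ev by (auto simp: less_top[symmetric])
  let ?w = "real_cond_exp M FX b"
  have wG: "?w \<in> borel_measurable G"
    using meas[OF \<open>B \<in> sets MY\<close>] unfolding cond_prob_field_def b_def .
  have iw: "integrable M (\<lambda>\<omega>. a \<omega> * ?w \<omega>)"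
    by (rule FX.real_cond_exp_intg(1)) (use int aX in auto)
  have 1: "AE \<omega> in M. real_cond_exp M G (real_cond_exp M FX (\<lambda>\<omega>. a \<omega> * b \<omega>)) \<omega>
             = real_cond_exp M G (\<lambda>\<omega>. a \<omega> * b \<omega>) \<omega>"
    by (rule G.real_cond_exp_nested_subalg[OF subalgebra_FX G int(3)])
  have 2: "AE \<omega> in M. real_cond_exp M G (real_cond_exp M FX (\<lambda>\<omega>. a \<omega> * b \<omega>)) \<omega>
             = real_cond_exp M G (\<lambda>\<omega>. ?w \<omega> * a \<omega>) \<omega>"
  proof (rule G.real_cond_exp_cong)
    show "AE \<omega> in M. real_cond_exp M FX (\<lambda>\<omega>. a \<omega> * b \<omega>) \<omega> = ?w \<omega> * a \<omega>"
      using FX.real_cond_exp_mult[OF aX b int(3)] by (simp add: mult.commute)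
  qed measurable
  have 3: "AE \<omega> in M. real_cond_exp M G (\<lambda>\<omega>. ?w \<omega> * a \<omega>) \<omega> = ?w \<omega> * real_cond_exp M G a \<omega>"
    by (rule G.real_cond_exp_mult) (use wG iw in \<open>auto simp: mult.commute\<close>)
  have 4: "AE \<omega> in M. real_cond_exp M G ?w \<omega> = real_cond_exp M G b \<omega>"
    by (rule G.real_cond_exp_nested_subalg[OF subalgebra_FX G int(2)])
  have 5: "AE \<omega> in M. real_cond_exp M G ?w \<omega> = ?w \<omega>"
    by (rule G.real_cond_exp_F_meas[OF FX.real_cond_exp_int(1)[OF int(2)] wG])
  show "AE \<omega> in M. cond_prob_field M G (X -` A \<inter> space M \<inter> event_Y B) \<omega> =
      cond_prob_field M G (X -` A \<inter> space M) \<omega> * cond_prob_field M G (event_Y B) \<omega>"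
    unfolding cond_prob_field_def ab[symmetric] a_def[symmetric] b_def[symmetric]
    using 1 2 3 4 5 by eventually_elim (metis mult.commute)
qed

text \<open>
  Conversely, under conditional independence \<open>P(Y \<in> B | H)\<close> has the integrals over the sets
  of \<open>\<sigma>(X)\<close> that characterize \<open>P(Y \<in> B | X)\<close>.
\<close>

lemma sufficient_field_cond_prob_eq:
  assumes H: "sufficient_field M MX MY X Y H" and B: "B \<in> sets MY"
  shows "AE \<omega> in M. cond_prob_field M FX (event_Y B) \<omega> = cond_prob_field M H (event_Y B) \<omega>"
proof -
  have sub: "subalgebra FX H" and ci: "cond_indep_given M MX MY X Y H"
    using H by (auto simp: sufficient_field_def)
  interpret FX: sigma_finite_subalgebra M FX
    by (rule sigma_finite_subalgebraI[OF subalgebra_FX])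
  interpret H: sigma_finite_subalgebra M H
    by (rule sigma_finite_subalgebraI[OF subalgebra_trans[OF sub]])
  define b :: "'a \<Rightarrow> real" where "b = indicator (event_Y B)"
  have ev: "event_Y B \<in> sets M" using B by measurable
  have b [measurable]: "b \<in> borel_measurable M" and ib: "integrable M b"
    unfolding b_def using ev by (auto simp: less_top[symmetric])
  let ?v = "real_cond_exp M H b"
  have "AE \<omega> in M. real_cond_exp M FX b \<omega> = ?v \<omega>"
  proof (rule FX.real_cond_exp_charact)
    show "integrable M b" by (rule ib)
    show iv: "integrable M ?v" by (rule H.real_cond_exp_int(1)[OF ib])
    show "?v \<in> borel_measurable FX"
      by (rule measurable_from_subalg[OF sub]) simp
    fix A' assume "A' \<in> sets FX"
    then obtain A where A: "A \<in> sets MX" "A' = X -` A \<inter> space M"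
      by (auto simp: sets_FX)
    have A' [measurable]: "A' \<in> sets M" using A by simp
    define a :: "'a \<Rightarrow> real" where "a = indicator A'"
    have a [measurable]: "a \<in> borel_measurable M" unfolding a_def by measurable
    have ab: "(\<lambda>\<omega>. a \<omega> * b \<omega>) = indicator (A' \<inter> event_Y B)"
      unfolding a_def b_def by (auto simp: fun_eq_iff indicator_inter_arith)
    have int: "integrable M a" "integrable M (\<lambda>\<omega>. a \<omega> * b \<omega>)"
      unfolding ab unfolding a_def using ev by (auto simp: less_top[symmetric])
    have iva: "integrable M (\<lambda>\<omega>. ?v \<omega> * a \<omega>)"
      using integrable_mult_indicator[OF A' iv] by (simp add: a_def mult.commute)
    have "(\<integral>\<omega>. a \<omega> * b \<omega> \<partial>M) = (\<integral>\<omega>. real_cond_exp M H (\<lambda>\<omega>. a \<omega> * b \<omega>) \<omega> \<partial>M)"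
      by (rule H.real_cond_exp_int(2)[OF int(2), symmetric])
    also have "\<dots> = (\<integral>\<omega>. real_cond_exp M H (\<lambda>\<omega>. ?v \<omega> * a \<omega>) \<omega> \<partial>M)"
    proof (rule integral_cong_AE)
      have "AE \<omega> in M. real_cond_exp M H (\<lambda>\<omega>. a \<omega> * b \<omega>) \<omega> = real_cond_exp M H a \<omega> * ?v \<omega>"
        using ci A B unfolding cond_indep_given_def cond_prob_field_def ab
        unfolding a_def b_def by auto
      moreover have "AE \<omega> in M. real_cond_exp M H (\<lambda>\<omega>. ?v \<omega> * a \<omega>) \<omega> = ?v \<omega> * real_cond_exp M H a \<omega>"
        by (rule H.real_cond_exp_mult) (use iva in auto)
      ultimately show "AE \<omega> in M. real_cond_exp M H (\<lambda>\<omega>. a \<omega> * b \<omega>) \<omega>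
          = real_cond_exp M H (\<lambda>\<omega>. ?v \<omega> * a \<omega>) \<omega>"
        by eventually_elim simp
    qed simp_all
    also have "\<dots> = (\<integral>\<omega>. ?v \<omega> * a \<omega> \<partial>M)"
      by (rule H.real_cond_exp_int(2)[OF iva])
    finally show "(\<integral>\<omega>\<in>A'. b \<omega> \<partial>M) = (\<integral>\<omega>\<in>A'. ?v \<omega> \<partial>M)"
      by (simp add: set_lebesgue_integral_def a_def mult.commute)
  qed
  then show ?thesis unfolding cond_prob_field_def b_def .
qed

text \<open>
  The events that agree almost surely with an event of \<open>H\<close> form a \<sigma>-field, so only generators
  need to be approximated.
\<close>

lemma subfield_mod_null_sigma_sets:
  assumes gen: "\<And>A. A \<in> \<A> \<Longrightarrow> \<exists>B\<in>sets H. AE \<omega> in M. \<omega> \<in> A \<longleftrightarrow> \<omega> \<in> B"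
    and G: "sets G = sigma_sets (space M) \<A>" and H: "space H = space M"
  shows "subfield_mod_null M G H"
  unfolding subfield_mod_null_def G
proof
  fix A assume "A \<in> sigma_sets (space M) \<A>"
  then show "\<exists>B\<in>sets H. AE \<omega> in M. \<omega> \<in> A \<longleftrightarrow> \<omega> \<in> B"
  proof induction
    case (Basic A)
    then show ?case by (rule gen)
  next
    case Empty
    then show ?case by (intro bexI[of _ "{}"]) auto
  next
    case (Compl A)
    then obtain B where B: "B \<in> sets H" "AE \<omega> in M. \<omega> \<in> A \<longleftrightarrow> \<omega> \<in> B" by auto
    have "space M - B \<in> sets H" using sets.compl_sets[OF B(1)] H by simp
    with B(2) show ?case
      by (intro bexI[of _ "space M - B"]) auto
  next
    case (Union A)
    then obtain B where B: "\<And>i::nat. B i \<in> sets H" "\<And>i. AE \<omega> in M. \<omega> \<in> A i \<longleftrightarrow> \<omega> \<in> B i"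
      by metis
    then have "AE \<omega> in M. \<forall>i. \<omega> \<in> A i \<longleftrightarrow> \<omega> \<in> B i" by (simp add: AE_all_countable)
    then show ?case
      using B(1) by (intro bexI[of _ "\<Union>i. B i"]) auto
  qed
qed

theorem central_field_regression_field: "central_field M MX MY X Y regression_field"
  unfolding central_field_def
proof (intro conjI allI impI)
  show "sufficient_field M MX MY X Y regression_field"
    unfolding sufficient_field_def
    by (intro conjI subalgebra_regression_field cond_indep_given_if_measurable
          cond_prob_field_regression_measurable)
next
  fix H assume H: "sufficient_field M MX MY X Y H"
  then have "space H = space M"
    by (auto simp: sufficient_field_def subalgebra_def)
  with sets_regression_field show "subfield_mod_null M regression_field H"
  proof (rule subfield_mod_null_sigma_sets[rotated])
    fix A
    assume "A \<in> {cond_prob_field M FX (event_Y B) -` S \<inter> space M | B S.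
                    B \<in> sets MY \<and> S \<in> sets borel}"
    then obtain B S where BS: "B \<in> sets MY" "S \<in> sets borel"
      and A: "A = cond_prob_field M FX (event_Y B) -` S \<inter> space M" by auto
    let ?C = "cond_prob_field M H (event_Y B) -` S \<inter> space H"
    have "?C \<in> sets H"
      by (rule measurable_sets[OF _ BS(2)]) (simp add: cond_prob_field_def)
    moreover have "AE \<omega> in M. \<omega> \<in> A \<longleftrightarrow> \<omega> \<in> ?C"
      using sufficient_field_cond_prob_eq[OF H BS(1)]
      unfolding A \<open>space H = space M\<close> by eventually_elim auto
    ultimately show "\<exists>B\<in>sets H. AE \<omega> in M. \<omega> \<in> A \<longleftrightarrow> \<omega> \<in> B" by blast
  qed
qed

section \<open>Residuals are orthogonal to functions of Y\<close>

text \<open>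
  It is enough to test \<open>r\<close> against indicators of events \<open>Y \<in> B\<close>, since this shows
  \<open>E[r | Y] = 0\<close>; no approximation of \<open>u\<close> is involved.
\<close>

lemma orthogonal_if_cond_exp_regression_zero:
  fixes r :: "'a \<Rightarrow> real" and u :: "'c \<Rightarrow> real"
  assumes rX: "r \<in> borel_measurable FX" and ir: "integrable M r"
    and r0: "AE \<omega> in M. real_cond_exp M regression_field r \<omega> = 0"
    and u [measurable]: "u \<in> borel_measurable MY"
    and iru: "integrable M (\<lambda>\<omega>. r \<omega> * u (Y \<omega>))"
  shows "(\<integral>\<omega>. r \<omega> * u (Y \<omega>) \<partial>M) = 0"
proof -
  interpret FX: sigma_finite_subalgebra M FX
    by (rule sigma_finite_subalgebraI[OF subalgebra_FX])
  interpret FY: sigma_finite_subalgebra M FY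
    by (rule sigma_finite_subalgebraI[OF subalgebra_FY])
  interpret G: sigma_finite_subalgebra M regression_field
    by (rule sigma_finite_subalgebraI[OF subalgebra_trans[OF subalgebra_regression_field]])
  have rM [measurable]: "r \<in> borel_measurable M" by (rule borel_measurable_integrable[OF ir])
  have rY: "AE \<omega> in M. real_cond_exp M FY r \<omega> = 0"
  proof (rule FY.real_cond_exp_charact)
    fix A assume "A \<in> sets FY"
    then obtain B where B: "B \<in> sets MY" "A = event_Y B" by (auto simp: sets_FY)
    have A [measurable]: "A \<in> sets M" using B by simp
    define b :: "'a \<Rightarrow> real" where "b = indicator A"
    have b [measurable]: "b \<in> borel_measurable M" unfolding b_def by measurable
    let ?w = "real_cond_exp M FX b"
    have wG: "?w \<in> borel_measurable regression_field"
      using cond_prob_field_regression_measurable[OF B(1)]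
      unfolding cond_prob_field_def b_def B(2) .
    have irb: "integrable M (\<lambda>\<omega>. r \<omega> * b \<omega>)"
      using integrable_mult_indicator[OF A ir] by (simp add: b_def mult.commute)
    have "(\<integral>\<omega>. r \<omega> * b \<omega> \<partial>M) = (\<integral>\<omega>. r \<omega> * ?w \<omega> \<partial>M)"
      by (rule FX.real_cond_exp_intg(2)[OF irb rX b, symmetric])
    also have "\<dots> = (\<integral>\<omega>. ?w \<omega> * real_cond_exp M regression_field r \<omega> \<partial>M)"
      using G.real_cond_exp_intg(2)[OF _ wG rM] FX.real_cond_exp_intg(1)[OF irb rX b]
      by (simp add: mult.commute)
    also have "\<dots> = (\<integral>\<omega>. 0 \<partial>M)"
      by (rule integral_cong_AE) (use r0 in auto)
    finally show "(\<integral>\<omega>\<in>A. r \<omega> \<partial>M) = (\<integral>\<omega>\<in>A. 0 \<partial>M)"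
      by (simp add: set_lebesgue_integral_def b_def mult.commute)
  qed (use ir in auto)
  have uY: "(\<lambda>\<omega>. u (Y \<omega>)) \<in> borel_measurable FY"
    unfolding generated_field_def
    by (rule measurable_compose[OF measurable_vimage_algebra1 u])
       (use measurable_space[OF Y] in auto)
  have "(\<integral>\<omega>. u (Y \<omega>) * r \<omega> \<partial>M) = (\<integral>\<omega>. u (Y \<omega>) * real_cond_exp M FY r \<omega> \<partial>M)"
    by (rule FY.real_cond_exp_intg(2)[OF _ uY rM, symmetric])
       (use iru in \<open>simp add: mult.commute\<close>)
  also have "\<dots> = (\<integral>\<omega>. 0 \<partial>M)"
    by (rule integral_cong_AE) (use rY in auto)
  finally show ?thesis by (simp add: mult.commute)
qed

section \<open>Transfer to the joint distribution\<close>

abbreviation PXY :: "('b \<times> 'c) measure" where "PXY \<equiv> joint_distr M MX MY X Y"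

abbreviation LX :: "('b \<times> 'c \<Rightarrow> real) set" where "LX \<equiv> L2c_lift PXY fst (L2c (distr M MX X))"

abbreviation LY :: "('b \<times> 'c \<Rightarrow> real) set" where "LY \<equiv> L2c_lift PXY snd (L2c (distr M MY Y))"

lemma pair_measurable: "(\<lambda>\<omega>. (X \<omega>, Y \<omega>)) \<in> measurable M (MX \<Otimes>\<^sub>M MY)"
  by measurable

lemma measurable_PXY_iff: "h \<in> borel_measurable PXY \<longleftrightarrow> h \<in> borel_measurable (MX \<Otimes>\<^sub>M MY)"
  by (simp add: joint_distr_def)

lemma integral_PXY:
  fixes h :: "'b \<times> 'c \<Rightarrow> real"
  assumes "h \<in> borel_measurable PXY"
  shows "(\<integral>z. h z \<partial>PXY) = (\<integral>\<omega>. h (X \<omega>, Y \<omega>) \<partial>M)"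
  using assms unfolding joint_distr_def by (simp add: integral_distr)

lemma AE_PXY_imp: "AE z in PXY. Q z \<Longrightarrow> AE \<omega> in M. Q (X \<omega>, Y \<omega>)"
  unfolding joint_distr_def by (rule AE_distrD[OF pair_measurable])

lemma L2c_distr_iff:
  assumes Z: "Z \<in> measurable M N"
  shows "f \<in> L2c (distr M N Z) \<longleftrightarrow> f \<in> borel_measurable N \<and>
    integrable M (\<lambda>\<omega>. (f (Z \<omega>))\<^sup>2) \<and> (\<integral>\<omega>. f (Z \<omega>) \<partial>M) = 0"
proof (cases "f \<in> borel_measurable N")
  case True
  then have "(\<lambda>x. (f x)\<^sup>2) \<in> borel_measurable N" by measurable
  with True show ?thesis
    by (simp add: L2c_def integrable_distr_eq[OF Z] integral_distr[OF Z])
next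
  case False
  then show ?thesis by (simp add: L2c_def)
qed

lemma L2c_PXY_iff:
  "h \<in> L2c PXY \<longleftrightarrow> h \<in> borel_measurable PXY \<and>
    integrable M (\<lambda>\<omega>. (h (X \<omega>, Y \<omega>))\<^sup>2) \<and> (\<integral>\<omega>. h (X \<omega>, Y \<omega>) \<partial>M) = 0"
  unfolding measurable_PXY_iff unfolding joint_distr_def
  by (rule L2c_distr_iff[OF pair_measurable])

lemma fst_in_LX:
  assumes f: "f \<in> L2c (distr M MX X)"
  shows "(\<lambda>z. f (fst z)) \<in> LX"
proof -
  have [measurable]: "f \<in> borel_measurable MX"
    using f unfolding L2c_distr_iff[OF X] by blast
  have "(\<lambda>z. f (fst z)) \<in> borel_measurable PXY"
    unfolding measurable_PXY_iff by measurable
  then have "(\<lambda>z. f (fst z)) \<in> L2c PXY"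
    using f unfolding L2c_PXY_iff L2c_distr_iff[OF X] by simp
  with f show ?thesis
    unfolding L2c_lift_def by blast
qed

text \<open>
  The witness against which \<open>h\<close> is tested is the residual \<open>f - g\<close>, where \<open>g(X)\<close> is the
  conditional expectation of \<open>f(X)\<close> given the regression field.
\<close>

theorem ominus_subset_central_class:
  "L2_ominus PXY LX (L2_ominus PXY LX LY) \<subseteq> L2c_lift PXY fst (central_class M MX MY X Y)"
proof
  fix h assume h: "h \<in> L2_ominus PXY LX (L2_ominus PXY LX LY)"
  then have "h \<in> LX" and h_orth: "\<And>k. k \<in> L2_ominus PXY LX LY \<Longrightarrow> (\<integral>z. h z * k z \<partial>PXY) = 0"
    unfolding L2_ominus_def by blast+
  then obtain f where hL: "h \<in> L2c PXY" and f: "f \<in> L2c (distr M MX X)"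
    and hf: "AE z in PXY. h z = f (fst z)"
    unfolding L2c_lift_def by blast
  have fm [measurable]: "f \<in> borel_measurable MX" and f2: "integrable M (\<lambda>\<omega>. (f (X \<omega>))\<^sup>2)"
    and f0: "(\<integral>\<omega>. f (X \<omega>) \<partial>M) = 0"
    using f unfolding L2c_distr_iff[OF X] by blast+
  let ?G = regression_field
  let ?f = "\<lambda>\<omega>. f (X \<omega>)"
  have subG: "subalgebra M ?G" by (rule subalgebra_trans[OF subalgebra_regression_field])
  interpret G: sigma_finite_subalgebra M ?G by (rule sigma_finite_subalgebraI[OF subG])
  define e where "e = real_cond_exp M ?G ?f"
  have eG: "e \<in> borel_measurable ?G" and [measurable]: "e \<in> borel_measurable M"
    unfolding e_def by simp_all
  have intf: "integrable M ?f" by (rule square_integrable_imp_integrable[OF _ f2]) measurable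
  have inte: "integrable M e" and e0: "(\<integral>\<omega>. e \<omega> \<partial>M) = 0"
    unfolding e_def using G.real_cond_exp_int[OF intf] f0 by auto
  have e2: "integrable M (\<lambda>\<omega>. (e \<omega>)\<^sup>2)"
    unfolding e_def by (rule G.integrable_square_real_cond_exp[OF intf f2])
  have eX: "e \<in> borel_measurable FX"
    by (rule measurable_from_subalg[OF subalgebra_regression_field eG])
  obtain g where g [measurable]: "g \<in> borel_measurable MX"
    and ge: "\<And>\<omega>. \<omega> \<in> space M \<Longrightarrow> e \<omega> = g (X \<omega>)"
    by (rule vimage_algebra_factorization[OF _ eX[unfolded generated_field_def]])
       (use measurable_space[OF X] in auto)
  define r where "r = (\<lambda>\<omega>. ?f \<omega> - e \<omega>)"
  have [measurable]: "r \<in> borel_measurable M" unfolding r_def by measurable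
  have intr: "integrable M r" unfolding r_def using intf inte by simp
  have r2: "integrable M (\<lambda>\<omega>. (r \<omega>)\<^sup>2)"
    unfolding r_def by (rule integrable_square_diff[OF _ _ f2 e2]) measurable
  have fX: "?f \<in> borel_measurable FX"
    unfolding generated_field_def
    by (rule measurable_compose[OF measurable_vimage_algebra1 fm])
       (use measurable_space[OF X] in auto)
  have rX: "r \<in> borel_measurable FX"
    unfolding r_def using fX eX by measurable
  have r0: "AE \<omega> in M. real_cond_exp M ?G r \<omega> = 0"
    using G.real_cond_exp_diff[OF intf inte] G.real_cond_exp_F_meas[OF inte eG]
    unfolding r_def e_def[symmetric] by eventually_elim simp
  define k where "k = (\<lambda>z::'b \<times> 'c. f (fst z) - g (fst z))"
  have kr: "k (X \<omega>, Y \<omega>) = r \<omega>" if "\<omega> \<in> space M" for \<omega>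
    using ge[OF that] by (simp add: k_def r_def)
  have "(\<lambda>x. f x - g x) \<in> L2c (distr M MX X)"
    unfolding L2c_distr_iff[OF X]
  proof (intro conjI)
    show "integrable M (\<lambda>\<omega>. (f (X \<omega>) - g (X \<omega>))\<^sup>2)"
      using r2 by (subst Bochner_Integration.integrable_cong[OF refl, where g = "\<lambda>\<omega>. (r \<omega>)\<^sup>2"])
        (auto simp: r_def ge)
    have "(\<integral>\<omega>. f (X \<omega>) - g (X \<omega>) \<partial>M) = (\<integral>\<omega>. r \<omega> \<partial>M)"
      by (rule Bochner_Integration.integral_cong) (auto simp: r_def ge)
    also have "\<dots> = 0" unfolding r_def using intf inte f0 e0 by simp
    finally show "(\<integral>\<omega>. f (X \<omega>) - g (X \<omega>) \<partial>M) = 0" .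
  qed measurable
  then have kX: "k \<in> LX" unfolding k_def by (rule fst_in_LX)
  then have [measurable]: "k \<in> borel_measurable PXY"
    by (simp add: L2c_lift_def L2c_def)
  have kY: "(\<integral>z. k z * v z \<partial>PXY) = 0" if v: "v \<in> LY" for v
  proof -
    obtain u where vL: "v \<in> L2c PXY" and u: "u \<in> L2c (distr M MY Y)"
      and vu: "AE z in PXY. v z = u (snd z)"
      using v unfolding L2c_lift_def by blast
    have [measurable]: "v \<in> borel_measurable PXY" using vL by (simp add: L2c_def)
    have um [measurable]: "u \<in> borel_measurable MY" and u2: "integrable M (\<lambda>\<omega>. (u (Y \<omega>))\<^sup>2)"
      using u unfolding L2c_distr_iff[OF Y] by blast+
    have [measurable]: "v \<in> borel_measurable (MX \<Otimes>\<^sub>M MY)" "k \<in> borel_measurable (MX \<Otimes>\<^sub>M MY)"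
      by (simp_all flip: measurable_PXY_iff)
    have "(\<integral>z. k z * v z \<partial>PXY) = (\<integral>\<omega>. k (X \<omega>, Y \<omega>) * v (X \<omega>, Y \<omega>) \<partial>M)"
      by (rule integral_PXY) measurable
    also have "\<dots> = (\<integral>\<omega>. r \<omega> * u (Y \<omega>) \<partial>M)"
    proof (rule integral_cong_AE)
      show "AE \<omega> in M. k (X \<omega>, Y \<omega>) * v (X \<omega>, Y \<omega>) = r \<omega> * u (Y \<omega>)"
        using AE_PXY_imp[OF vu] AE_space by eventually_elim (simp add: kr)
    qed measurable
    also have "\<dots> = 0"
      by (rule orthogonal_if_cond_exp_regression_zero[OF rX intr r0 um])
         (rule integrable_mult_of_square_integrable[OF _ _ r2 u2]; measurable)
    finally show ?thesis .
  qed
  have [measurable]: "h \<in> borel_measurable PXY" using hL by (simp add: L2c_def)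
  have [measurable]: "h \<in> borel_measurable (MX \<Otimes>\<^sub>M MY)" "k \<in> borel_measurable (MX \<Otimes>\<^sub>M MY)"
    by (simp_all flip: measurable_PXY_iff)
  have "0 = (\<integral>z. h z * k z \<partial>PXY)"
    using kX kY by (intro h_orth[symmetric]) (simp add: L2_ominus_def)
  also have "\<dots> = (\<integral>\<omega>. h (X \<omega>, Y \<omega>) * k (X \<omega>, Y \<omega>) \<partial>M)"
    by (rule integral_PXY) measurable
  also have "\<dots> = (\<integral>\<omega>. ?f \<omega> * r \<omega> \<partial>M)"
  proof (rule integral_cong_AE)
    show "AE \<omega> in M. h (X \<omega>, Y \<omega>) * k (X \<omega>, Y \<omega>) = ?f \<omega> * r \<omega>"
      using AE_PXY_imp[OF hf] AE_space by eventually_elim (simp add: kr)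
  qed measurable
  finally have fr: "(\<integral>\<omega>. ?f \<omega> * r \<omega> \<partial>M) = 0" by simp
  have ifr: "integrable M (\<lambda>\<omega>. ?f \<omega> * r \<omega>)" and ier: "integrable M (\<lambda>\<omega>. e \<omega> * r \<omega>)"
    by (rule integrable_mult_of_square_integrable[OF _ _ _ r2]; use f2 e2 in measurable)+
  have "(\<integral>\<omega>. e \<omega> * r \<omega> \<partial>M) = (\<integral>\<omega>. e \<omega> * real_cond_exp M ?G r \<omega> \<partial>M)"
    by (rule G.real_cond_exp_intg(2)[OF ier eG, symmetric]) measurable
  also have "\<dots> = (\<integral>\<omega>. 0 \<partial>M)"
    by (rule integral_cong_AE) (use r0 in auto)
  finally have er: "(\<integral>\<omega>. e \<omega> * r \<omega> \<partial>M) = 0" by simp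
  have "(\<integral>\<omega>. (r \<omega>)\<^sup>2 \<partial>M) = (\<integral>\<omega>. ?f \<omega> * r \<omega> - e \<omega> * r \<omega> \<partial>M)"
    by (simp add: r_def power2_eq_square algebra_simps)
  also have "\<dots> = 0"
    using fr er ifr ier by simp
  finally have "AE \<omega> in M. (r \<omega>)\<^sup>2 = 0"
    using integral_nonneg_eq_0_iff_AE[OF r2] by simp
  then have "AE \<omega> in M. f (X \<omega>) = e \<omega>"
    by eventually_elim (simp add: r_def)
  then have "f \<in> central_class M MX MY X Y"
    unfolding central_class_def using f eG central_field_regression_field by blast
  with hL hf show "h \<in> L2c_lift PXY fst (central_class M MX MY X Y)"
    unfolding L2c_lift_def by blast
qed

end

theorem theorem2:
  fixes M :: "'a measure" and MX :: "'b measure" and MY :: "'c measure"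
    and X :: "'a \<Rightarrow> 'b" and Y :: "'a \<Rightarrow> 'c" and K :: "'c \<Rightarrow> 'b measure"
  assumes "prob_space M"
    and "X \<in> measurable M MX"
    and "Y \<in> measurable M MY"
    and "regular_cond_distr M MX MY X Y K"
    and "dominated_family MX K (space MY)"
  defines "P \<equiv> joint_distr M MX MY X Y"
  defines "LX \<equiv> L2c_lift P fst (L2c (distr M MX X))"
  defines "LY \<equiv> L2c_lift P snd (L2c (distr M MY Y))"
  shows "L2_ominus P LX (L2_ominus P LX LY) \<subseteq> L2c_lift P fst (central_class M MX MY X Y)"
proof -
  interpret random_pair M MX MY X Y
    using assms(1-3) by (intro random_pair.intro random_pair_axioms.intro)
  show ?thesis
    unfolding P_def LX_def LY_def by (rule ominus_subset_central_class)
qed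

end
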